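(* The functions $g_1^4(\tau)$ and $g_2^4(\tau)$ are modular functions on $\Gamma_1(10)$, and the functions $T_1(\tau)$ and $T_2(\tau)$ are modular functions on $\Gamma_1(40)$.
   Context: $\tau\in\mathbb{H}$, $q=e^{2\pi i\tau}$, $(a;q)_\infty=\prod_{n\ge0}(1-aq^n)$. Define $T_1(\tau)=\dfrac{(-q;q^5)_\infty(-q^4;q^5)_\infty-(q;q^5)_\infty(q^4;q^5)_\infty}{(-q;q^5)_\infty(-q^4;q^5)_\infty+(q;q^5)_\infty(q^4;q^5)_\infty}$, $T_2(\tau)=\dfrac{(-q^2;q^5)_\infty(-q^3;q^5)_\infty-(q^2;q^5)_\infty(q^3;q^5)_\infty}{(-q^2;q^5)_\infty(-q^3;q^5)_\infty+(q^2;q^5)_\infty(q^3;q^5)_\infty}$, $g_1(\tau)=\dfrac{(-q;q^5)_\infty(-q^4;q^5)_\infty}{(q;q^5)_\infty(q^4;q^5)_\infty}$, $g_2(\tau)=\dfrac{(-q^2;q^5)_\infty(-q^3;q^5)_\infty}{(q^2;q^5)_\infty(q^3;q^5)_\infty}$. $\Gamma_1(N)$ is the group of $\begin{bmatrix} a&b\\ c&d\end{bmatrix}\in\mathrm{SL}_2(\mathbb{Z})$ with $a\equiv d\equiv1$, $c\equiv0\pmod N$. A modular function on $\Gamma$ is a function meromorphic on $\mathbb{H}$, invariant under $\Gamma$, and meromorphic at all cusps. *)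

theory Defs
  imports "HOL-Complex_Analysis.Complex_Analysis"
begin

definition upper_half_plane :: "complex set" where
  "upper_half_plane = {z. Im z > 0}"

definition nome :: "complex \<Rightarrow> complex" where
  "nome \<tau> = exp (2 * pi * \<i> * \<tau>)"

definition qpoch :: "complex \<Rightarrow> complex \<Rightarrow> complex" where
  "qpoch a q = prodinf (\<lambda>n. 1 - a * q ^ n)"

definition T1 :: "complex \<Rightarrow> complex" where
  "T1 \<tau> = (let q = nome \<tau> in
     (qpoch (-q) (q^5) * qpoch (-(q^4)) (q^5) - qpoch q (q^5) * qpoch (q^4) (q^5)) /
     (qpoch (-q) (q^5) * qpoch (-(q^4)) (q^5) + qpoch q (q^5) * qpoch (q^4) (q^5)))"

definition T2 :: "complex \<Rightarrow> complex" where
  "T2 \<tau> = (let q = nome \<tau> in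
     (qpoch (-(q^2)) (q^5) * qpoch (-(q^3)) (q^5) - qpoch (q^2) (q^5) * qpoch (q^3) (q^5)) /
     (qpoch (-(q^2)) (q^5) * qpoch (-(q^3)) (q^5) + qpoch (q^2) (q^5) * qpoch (q^3) (q^5)))"

definition g1 :: "complex \<Rightarrow> complex" where
  "g1 \<tau> = (let q = nome \<tau> in
     (qpoch (-q) (q^5) * qpoch (-(q^4)) (q^5)) / (qpoch q (q^5) * qpoch (q^4) (q^5)))"

definition g2 :: "complex \<Rightarrow> complex" where
  "g2 \<tau> = (let q = nome \<tau> in
     (qpoch (-(q^2)) (q^5) * qpoch (-(q^3)) (q^5)) / (qpoch (q^2) (q^5) * qpoch (q^3) (q^5)))"

text \<open>Matrices [[a,b],[c,d]] are represented as tuples (a,b,c,d).\<close>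
definition SL2Z :: "(int \<times> int \<times> int \<times> int) set" where
  "SL2Z = {(a,b,c,d). a * d - b * c = 1}"

definition Gamma1 :: "nat \<Rightarrow> (int \<times> int \<times> int \<times> int) set" where
  "Gamma1 N = {(a,b,c,d). a * d - b * c = 1 \<and> a mod int N = 1 mod int N \<and> d mod int N = 1 mod int N
                  \<and> int N dvd c}"

definition moebius :: "int \<times> int \<times> int \<times> int \<Rightarrow> complex \<Rightarrow> complex" where
  "moebius M \<tau> = (case M of (a,b,c,d) \<Rightarrow> (of_int a * \<tau> + of_int b) / (of_int c * \<tau> + of_int d))"

definition meromorphic_at_cusps :: "(complex \<Rightarrow> complex) \<Rightarrow> bool" where
  "meromorphic_at_cusps f \<longleftrightarrow>
     (\<forall>\<sigma>\<in>SL2Z. \<exists>h::nat. h > 0 \<and> (\<exists>G y0. G meromorphic_on {0} \<and>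
        (\<forall>\<tau>. Im \<tau> > y0 \<longrightarrow> f (moebius \<sigma> \<tau>) = G (exp (2 * pi * \<i> * \<tau> / of_nat h)))))"

text \<open>Modular function on a subgroup Gamma of SL2(Z): meromorphic on H, invariant under Gamma
  (as a meromorphic function, i.e. up to the values at isolated points), meromorphic at all cusps.\<close>
definition modular_function_on :: "(complex \<Rightarrow> complex) \<Rightarrow> (int \<times> int \<times> int \<times> int) set \<Rightarrow> bool" where
  "modular_function_on f \<Gamma> \<longleftrightarrow>
     f meromorphic_on upper_half_plane \<and>
     (\<forall>\<gamma>\<in>\<Gamma>. \<forall>z\<in>upper_half_plane. eventually (\<lambda>\<tau>. f (moebius \<gamma> \<tau>) = f \<tau>) (at z)) \<and>
     meromorphic_at_cusps f"

end

theory Submission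
  imports Defs
begin

text \<open>
  Up to the factor \<open>\<i>\<close>, \<open>g\<^sub>k(\<tau>)\<close> is the quotient \<open>\<theta>(k\<tau> + 1/2, 5\<tau>) / \<theta>(k\<tau>, 5\<tau>)\<close>, where
  \<open>\<theta>(z, \<tau>) = x\<^sup>-\<^sup>1\<^sup>/\<^sup>2 (x; p)\<^sub>\<infinity> (p/x; p)\<^sub>\<infinity>\<close> with \<open>x = e\<^sup>2\<^sup>\<pi>\<^sup>i\<^sup>z\<close> and \<open>p = e\<^sup>2\<^sup>\<pi>\<^sup>i\<^sup>\<tau>\<close>. For \<open>\<gamma> = (a, b; c, d)\<close> of
  determinant 1 the quotient of \<open>exp(- \<pi> i c z\<^sup>2/(c\<tau>+d)) \<theta>(z/(c\<tau>+d), \<gamma>\<tau>)\<close> and \<open>\<theta>(z, \<tau>)\<close> is entire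
  in \<open>z\<close> (both have simple zeros exactly on the lattice) and its modulus is doubly periodic, so it is
  constant by Liouville. The constant cancels in \<open>g\<^sub>k\<close>, which leaves an explicit fourth root of unity
  as multiplier on \<open>\<Gamma>\<^sub>1(10)\<close>; it is trivial on \<open>\<Gamma>\<^sub>1(40)\<close>. At a cusp \<open>\<sigma>\<close> one writes \<open>5\<sigma>\<tau> = \<gamma>T\<close> with
  \<open>T\<close> affine in \<open>\<tau>\<close>, and the same transformation formula expresses \<open>g\<^sub>k(\<sigma>\<tau>)\<close> through theta values at
  points \<open>mT/10 + v\<close>, whose product expansions are meromorphic in \<open>e\<^sup>2\<^sup>\<pi>\<^sup>i\<^sup>T\<^sup>/\<^sup>4\<^sup>0\<close>.
\<close>

section \<open>The q-Pochhammer symbol and the nome\<close>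

lemma convergent_prod_qpoch:
  fixes a q :: complex
  assumes "norm q < 1"
  shows "convergent_prod (\<lambda>n. 1 - a * q ^ n)"
proof -
  have "summable (\<lambda>n. norm a * norm q ^ n)"
    using assms by (intro summable_mult summable_geometric) auto
  hence "abs_convergent_prod (\<lambda>n. 1 - a * q ^ n)"
    by (intro summable_imp_abs_convergent_prod) (simp add: norm_mult norm_power)
  thus ?thesis
    by (rule abs_convergent_prod_imp_convergent_prod)
qed

lemma qpoch_eq_0_iff:
  assumes "norm q < 1"
  shows "qpoch a q = 0 \<longleftrightarrow> (\<exists>n. a * q ^ n = 1)"
  using has_prod_eq_0_iff[OF convergent_prod_has_prod[OF convergent_prod_qpoch[OF assms, of a]]]
  by (auto simp: qpoch_def image_iff)

lemma qpoch_nonzero: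
  assumes "norm a < 1" "norm q < 1"
  shows "qpoch a q \<noteq> 0"
proof
  assume "qpoch a q = 0"
  then obtain n where n: "a * q ^ n = 1" using qpoch_eq_0_iff[OF assms(2)] by blast
  have "norm a * norm q ^ n \<le> norm a * 1"
    using assms by (intro mult_left_mono power_le_one) auto
  thus False using arg_cong[OF n, of norm] assms by (simp add: norm_mult norm_power)
qed

lemma qpoch_rec:
  assumes "norm q < 1"
  shows "qpoch a q = (1 - a) * qpoch (a * q) q"
\<comment> \<open>Splitting off the head of the product divides by it, so a vanishing head is
  treated apart; both sides are then 0.\<close>
proof (cases "a = 1")
  case True
  thus ?thesis using qpoch_eq_0_iff[OF assms, of a] by (auto intro: exI[of _ 0])
next
  case False
  thus ?thesis
    using prodinf_split_head[OF convergent_prod_qpoch[OF assms, of a]]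
    by (simp add: qpoch_def mult.assoc)
qed

text \<open>The partial products converge locally uniformly: on a closed disc the moduli of
  \<open>a\<close> and \<open>q\<close> attain maxima, and the M-test compares with a geometric
  series whose ratio is the maximum of \<open>norm (q w)\<close>, which is below 1. Both arguments
  vary because the nome itself moves with \<tau>.\<close>

lemma holomorphic_on_qpoch:
  assumes "open A" and a: "a holomorphic_on A" and q: "q holomorphic_on A"
    and less: "\<And>z. z \<in> A \<Longrightarrow> norm (q z) < 1"
  shows "(\<lambda>z. qpoch (a z) (q z)) holomorphic_on A"
proof (rule holomorphic_uniform_sequence)
  show "(\<lambda>z. \<Prod>n<N. 1 - a z * q z ^ n) holomorphic_on A" for N
    by (intro holomorphic_intros a q)
  fix z assume "z \<in> A"
  then obtain d where d: "d > 0" "cball z d \<subseteq> A"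
    using \<open>open A\<close> open_contains_cball by blast
  let ?K = "cball z d"
  have ca: "continuous_on ?K a" and cq: "continuous_on ?K q"
    using d a q holomorphic_on_imp_continuous_on continuous_on_subset by blast+
  obtain x where x: "x \<in> ?K" "\<And>w. w \<in> ?K \<Longrightarrow> norm (q w) \<le> norm (q x)"
    using continuous_attains_sup[OF compact_cball _ continuous_on_norm[OF cq]] d by auto
  obtain y where y: "y \<in> ?K" "\<And>w. w \<in> ?K \<Longrightarrow> norm (a w) \<le> norm (a y)"
    using continuous_attains_sup[OF compact_cball _ continuous_on_norm[OF ca]] d by auto
  have "norm (q x) < 1" using x d less by blast
  have "uniformly_convergent_on ?K (\<lambda>N w. \<Prod>n<N. 1 - a w * q w ^ n)"
  proof (rule uniformly_convergent_on_prod')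
    show "uniformly_convergent_on ?K (\<lambda>N w. \<Sum>n<N. norm (1 - a w * q w ^ n - 1))"
    proof (rule Weierstrass_m_test'_ev)
      show "\<forall>\<^sub>F n in sequentially. \<forall>w\<in>?K.
              norm (norm (1 - a w * q w ^ n - 1)) \<le> norm (a y) * norm (q x) ^ n"
        by (auto intro!: always_eventually mult_mono power_mono x y simp del: mem_cball simp: norm_mult norm_power)
      show "summable (\<lambda>n. norm (a y) * norm (q x) ^ n)"
        using \<open>norm (q x) < 1\<close> by (intro summable_mult summable_geometric) auto
    qed
  qed (auto intro!: continuous_intros ca cq)
  then obtain g where g: "uniform_limit ?K (\<lambda>N w. \<Prod>n<N. 1 - a w * q w ^ n) g sequentially"
    by (auto simp: uniformly_convergent_on_def)
  also have "?this \<longleftrightarrow> uniform_limit ?K (\<lambda>N w. \<Prod>n<N. 1 - a w * q w ^ n)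
               (\<lambda>w. qpoch (a w) (q w)) sequentially"
  proof (intro uniform_limit_cong)
    fix w assume w: "w \<in> ?K"
    have "(\<lambda>N. \<Prod>n<N. 1 - a w * q w ^ n) \<longlonglongrightarrow> g w"
      using tendsto_uniform_limitI[OF g w] .
    moreover have "(\<lambda>N. \<Prod>n<N. 1 - a w * q w ^ n) \<longlonglongrightarrow> qpoch (a w) (q w)"
      using convergent_prod_LIMSEQ[OF convergent_prod_qpoch[OF less[of w], of "a w"]] w d
      by (auto simp: qpoch_def LIMSEQ_lessThan_iff_atMost)
    ultimately show "g w = qpoch (a w) (q w)"
      by (rule LIMSEQ_unique)
  qed auto
  finally show "\<exists>d>0. cball z d \<subseteq> A \<and> uniform_limit (cball z d)
                  (\<lambda>N w. \<Prod>n<N. 1 - a w * q w ^ n) (\<lambda>w. qpoch (a w) (q w)) sequentially"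
    using d by blast
qed fact

section \<open>The nome as a homomorphism from addition to multiplication\<close>

lemma nome_add: "nome (a + b) = nome a * nome b"
  by (simp add: nome_def exp_add ring_distribs)

lemma nome_minus: "nome (- a) = inverse (nome a)"
  by (simp add: nome_def exp_minus)

lemma nome_diff: "nome (a - b) = nome a / nome b"
  by (simp add: nome_def exp_diff ring_distribs)

lemma nome_nonzero [simp]: "nome z \<noteq> 0"
  by (simp add: nome_def)

lemma nome_0 [simp]: "nome 0 = 1"
  by (simp add: nome_def)

lemma nome_eq_1_iff: "nome z = 1 \<longleftrightarrow> z \<in> \<int>"
proof
  assume "nome z = 1"
  then obtain n :: int where "Im z = 0" "Re z = of_int n"
    by (auto simp: nome_def exp_eq_1)
  hence "z = of_int n" by (simp add: complex_eq_iff)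
  thus "z \<in> \<int>" by simp
next
  assume "z \<in> \<int>"
  then obtain n where "z = of_int n" by (auto elim: Ints_cases)
  thus "nome z = 1"
    by (simp add: nome_def exp_eq_1)
qed

lemma nome_of_int [simp]: "nome (of_int n) = 1"
  by (simp add: nome_eq_1_iff)

lemma nome_half: "nome (1/2) = -1"
  by (simp add: nome_def)

lemma nome_of_int_half: "nome (of_int n / 2) = (-1) powi n"
  using exp_power_int[of "2 * pi * \<i> * (1/2)" n]
  by (simp add: nome_def mult_ac)

lemma nome_of_int_mult: "nome (of_int n * z) = nome z powi n"
  using exp_power_int[of "2 * pi * \<i> * z" n]
  by (simp add: nome_def mult_ac)

lemma nome_of_nat_mult: "nome (of_nat n * z) = nome z ^ n"
  using nome_of_int_mult[of "int n" z] by simp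

lemma nome_eqI: "x - y \<in> \<int> \<Longrightarrow> nome x = nome y"
  using nome_diff[of x y] by (simp add: nome_eq_1_iff [symmetric])

lemma norm_nome_less_1: "Im z > 0 \<Longrightarrow> norm (nome z) < 1"
  by (simp add: nome_def)

lemma holomorphic_on_nome [holomorphic_intros]:
  "f holomorphic_on A \<Longrightarrow> (\<lambda>z. nome (f z)) holomorphic_on A"
  unfolding nome_def by (intro holomorphic_intros)

section \<open>Theta functions and their modular transformation\<close>

text \<open>The zeros of \<open>D\<close> are simple and are zeros of \<open>N\<close>, so the
  quotient extends to an entire function. Boundedness needs periodicity of the modulus only, so
  signs and roots of unity in the quasi-periods never have to be matched. Liouville's theorem then
  applies.\<close>

lemma entire_quotient_constant:
  fixes N D :: "complex \<Rightarrow> complex" and \<tau> :: complex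
  assumes N: "N holomorphic_on UNIV" and D: "D holomorphic_on UNIV" and \<tau>: "Im \<tau> > 0"
    and zeros: "\<And>z. D z = 0 \<Longrightarrow> N z = 0 \<and> deriv D z \<noteq> 0"
    and per1: "\<And>z. norm (N (z + 1) / D (z + 1)) = norm (N z / D z)"
    and per2: "\<And>z. norm (N (z + \<tau>) / D (z + \<tau>)) = norm (N z / D z)"
  shows "\<exists>C. \<forall>z. N z = C * D z"
proof -
  define f where "f = (\<lambda>z. N z / D z)"
  have shift: "norm (f (z + of_int n * w)) = norm (f z)"
    if "\<And>z. norm (f (z + w)) = norm (f z)" for z w n
  proof (induction n rule: int_induct[of _ 0])
    case (step1 i)
    thus ?case using that[of "z + of_int i * w"] by (simp add: algebra_simps)
  next
    case (step2 i)
    thus ?case using that[of "z + of_int (i - 1) * w"] by (simp add: algebra_simps)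
  qed auto
  have lim: "\<exists>c. f \<midarrow>z\<rightarrow> c" for z
  proof (cases "D z = 0")
    case False
    have "isCont N z" "isCont D z"
      using N D holomorphic_on_imp_continuous_on continuous_on_eq_continuous_at by blast+
    hence "isCont f z" using False unfolding f_def by (intro continuous_intros)
    thus ?thesis by (auto simp: isCont_def)
  next
    case True
    have "(N has_field_derivative deriv N z) (at z)" "(D has_field_derivative deriv D z) (at z)"
      using N D by (auto intro: holomorphic_derivI)
    hence "((\<lambda>w. (N w - N z) / (w - z)) \<longlongrightarrow> deriv N z) (at z)"
          "((\<lambda>w. (D w - D z) / (w - z)) \<longlongrightarrow> deriv D z) (at z)"
      by (simp_all add: has_field_derivative_iff)
    \<comment> \<open>At a simple zero of \<open>D\<close> the quotient of the two difference
      quotients tends to N'/D', so the singularity is removable.\<close>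
    hence "((\<lambda>w. ((N w - N z) / (w - z)) / ((D w - D z) / (w - z))) \<longlongrightarrow> deriv N z / deriv D z) (at z)"
      using zeros[OF True] by (intro tendsto_intros) auto
    also have "?this \<longleftrightarrow> (f \<longlongrightarrow> deriv N z / deriv D z) (at z)"
      using zeros[OF True] True
      by (intro filterlim_cong refl) (auto simp: eventually_at f_def intro!: exI[of _ 1])
    finally show ?thesis by blast
  qed
  define F where "F = remove_sings f"
  have isol: "isolated_singularity_at f z" for z
    unfolding f_def
    by (intro isolated_singularity_at_divide isolated_singularity_at_analytic not_essential_analytic)
       (use N D in \<open>auto simp: analytic_on_open intro: analytic_on_subset[of _ UNIV]\<close>)
  have F_lim: "f \<midarrow>z\<rightarrow> F z" for z
    using lim[of z] remove_sings_eqI unfolding F_def by blast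
  have "F analytic_on {z}" for z
    unfolding F_def using remove_sings_analytic_at[OF isol F_lim] .
  hence "F analytic_on UNIV"
    by (meson UNIV_I analytic_on_analytic_at)
  hence holF: "F holomorphic_on UNIV"
    by (rule analytic_imp_holomorphic)
  have F_eq: "F z = f z" if "D z \<noteq> 0" for z
  proof -
    have "isCont N z" "isCont D z"
      using N D holomorphic_on_imp_continuous_on continuous_on_eq_continuous_at by blast+
    hence "isCont f z" using that unfolding f_def by (intro continuous_intros)
    thus ?thesis using F_lim[of z] LIM_unique unfolding isCont_def by blast
  qed
  \<comment> \<open>The closed period parallelogram of the lattice spanned by 1 and \<tau>; taking
    fractional parts of the lattice coordinates moves every point into it.\<close>
  define K where "K = (\<lambda>(s, t). of_real s + of_real t * \<tau>) ` ({0..1::real} \<times> {0..1::real})"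
  have "compact K" unfolding K_def
    by (intro compact_continuous_image compact_Times)
       (auto intro!: continuous_intros simp: case_prod_unfold)
  moreover have "continuous_on K F"
    using holF holomorphic_on_imp_continuous_on continuous_on_subset by blast
  ultimately have "bounded (F ` K)"
    by (intro compact_imp_bounded compact_continuous_image)
  then obtain B where B: "B > 0" "\<And>z. z \<in> K \<Longrightarrow> norm (F z) \<le> B"
    by (auto simp: bounded_pos)
  have fB: "norm (f z) \<le> B" for z
  proof -
    define t where "t = Im z / Im \<tau>"
    define s where "s = Re z - t * Re \<tau>"
    have z: "z = of_real s + of_real t * \<tau>"
      using \<tau> by (simp add: complex_eq_iff s_def t_def)
    define w where "w = of_real (frac s) + of_real (frac t) * \<tau>"
    have "z = w + of_int \<lfloor>s\<rfloor> * 1 + of_int \<lfloor>t\<rfloor> * \<tau>"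
      by (simp add: z w_def frac_def algebra_simps)
    hence "norm (f z) = norm (f w)"
      using shift[of 1 w "\<lfloor>s\<rfloor>"] shift[of \<tau> "w + of_int \<lfloor>s\<rfloor> * 1" "\<lfloor>t\<rfloor>"] per1 per2
      by (simp add: f_def)
    moreover have "w \<in> K"
      unfolding K_def w_def
      by (rule image_eqI[of _ _ "(frac s, frac t)"]) (auto simp: frac_lt_1 less_imp_le)
    \<comment> \<open>At a zero of \<open>D\<close> the value of \<open>f\<close> is 0 by the
      convention for division; elsewhere it is that of \<open>F\<close>.\<close>
    moreover have "norm (f w) \<le> B" if "w \<in> K"
      using B(1) B(2)[OF that] F_eq[of w] by (cases "D w = 0") (auto simp: f_def)
    ultimately show ?thesis by simp
  qed
  have "norm (F z) \<le> B" for z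
    by (rule tendsto_upperbound[OF tendsto_norm[OF F_lim[of z]]]) (auto simp: fB)
  hence "bounded (range F)"
    by (auto simp: bounded_iff)
  then obtain C where C: "\<And>z. F z = C"
    using Liouville_theorem[OF holF] by (auto simp: constant_on_def)
  have "N z = C * D z" for z
    using F_eq[of z] C[of z] zeros[of z] by (cases "D z = 0") (auto simp: f_def field_simps)
  thus ?thesis by blast
qed

section \<open>The theta function: zeros and quasi-periods\<close>

text \<open>Jacobi's odd theta function up to a factor depending on \<tau> alone; such a factor
  cancels in every quotient below. The prefactor \<open>nome (- z / 2)\<close> fixes the square root
  of x, which makes the function single-valued in z.\<close>

definition theta :: "complex \<Rightarrow> complex \<Rightarrow> complex" where
  "theta z \<tau> = nome (- z / 2) * qpoch (nome z) (nome \<tau>) * qpoch (nome (\<tau> - z)) (nome \<tau>)"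

lemma holomorphic_on_theta:
  assumes "Im \<tau> > 0" "f holomorphic_on A" "open A"
  shows "(\<lambda>z. theta (f z) \<tau>) holomorphic_on A"
  unfolding theta_def
  by (intro holomorphic_intros holomorphic_on_qpoch assms norm_nome_less_1) auto

text \<open>The first product vanishes exactly at the lattice points with m \<le> 0, the second
  exactly at those with m > 0.\<close>

lemma theta_eq_0_iff:
  assumes "Im \<tau> > 0"
  shows "theta z \<tau> = 0 \<longleftrightarrow> (\<exists>m n. z = of_int m * \<tau> + of_int n)"
proof -
  have "theta z \<tau> = 0 \<longleftrightarrow> (\<exists>k. nome (z + of_nat k * \<tau>) = 1) \<or> (\<exists>k. nome (\<tau> - z + of_nat k * \<tau>) = 1)"
    using norm_nome_less_1[OF assms]
    by (simp add: theta_def qpoch_eq_0_iff nome_of_nat_mult nome_add)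
  also have "\<dots> \<longleftrightarrow> (\<exists>m n. z = of_int m * \<tau> + of_int n)"
  proof safe
    fix k assume "nome (z + of_nat k * \<tau>) = 1"
    then obtain n where "z + of_nat k * \<tau> = of_int n"
      by (auto simp: nome_eq_1_iff elim: Ints_cases)
    hence "z = of_int (- int k) * \<tau> + of_int n" by (simp add: algebra_simps)
    thus "\<exists>m n. z = of_int m * \<tau> + of_int n" by blast
  next
    fix k assume "nome (\<tau> - z + of_nat k * \<tau>) = 1"
    then obtain n where "\<tau> - z + of_nat k * \<tau> = of_int n"
      by (auto simp: nome_eq_1_iff elim: Ints_cases)
    hence "z = of_int (int k + 1) * \<tau> + of_int (- n)" by (simp add: algebra_simps)
    thus "\<exists>m n. z = of_int m * \<tau> + of_int n" by blast
  next
    fix m n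
    assume *: "\<nexists>k. nome (\<tau> - (of_int m * \<tau> + of_int n) + of_nat k * \<tau>) = 1"
    have "m \<le> 0"
    proof (rule ccontr)
      assume "\<not> m \<le> 0"
      hence "\<tau> - (of_int m * \<tau> + of_int n) + of_nat (nat (m - 1)) * \<tau> = of_int (- n)"
        by (simp add: algebra_simps)
      thus False using * nome_of_int by metis
    qed
    hence "of_int m * \<tau> + of_int n + of_nat (nat (- m)) * \<tau> = of_int n"
      by (simp add: algebra_simps)
    thus "\<exists>k. nome (of_int m * \<tau> + of_int n + of_nat k * \<tau>) = 1"
      using nome_of_int by metis
  qed
  finally show ?thesis .
qed

lemma theta_add_1: "theta (z + 1) \<tau> = - theta z \<tau>"
proof -
  have "nome (- (z + 1) / 2) = - nome (- z / 2)"
    using nome_of_int_half[of "-1"] nome_add[of "-z/2" "-1/2"] by (simp add: field_simps)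
  moreover have "nome (z + 1) = nome z" "nome (\<tau> - (z + 1)) = nome (\<tau> - z)"
    by (rule nome_eqI; simp)+
  ultimately show ?thesis by (simp add: theta_def)
qed

text \<open>The shift moves one factor from the first product to the second, and (1 - 1/x) = -(1/x)
  (1 - x). Cancelling 1 - x requires x \<noteq> 1; for x = 1 both sides contain the vanishing
  product \<open>qpoch 1 p\<close>.\<close>

lemma theta_add_tau:
  assumes "Im \<tau> > 0"
  shows "theta (z + \<tau>) \<tau> = - nome (- z - \<tau> / 2) * theta z \<tau>"
proof -
  define x p where "x = nome z" and "p = nome \<tau>"
  have p: "norm p < 1" using norm_nome_less_1[OF assms] by (simp add: p_def)
  have [simp]: "x \<noteq> 0" by (simp add: x_def)
  have 1: "qpoch (x * p) p * qpoch (1 / x) p = - (1 / x) * (qpoch x p * qpoch (p / x) p)"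
  proof (cases "x = 1")
    case True
    thus ?thesis using qpoch_rec[OF p, of 1] by simp
  next
    case False
    have "qpoch x p * (1 - 1 / x) * qpoch (p / x) p = (1 - x) * qpoch (x * p) p * qpoch (1 / x) p"
      using qpoch_rec[OF p, of x] qpoch_rec[OF p, of "1 / x"] by (simp add: mult_ac)
    thus ?thesis using False by (simp add: field_simps) algebra
  qed
  have "nome (- (z + \<tau>) / 2) = nome (- z / 2) * nome (- \<tau> / 2)"
    by (simp add: nome_add [symmetric] field_simps)
  moreover have "nome (- z - \<tau> / 2) = 1 / x * nome (- \<tau> / 2)"
    by (simp add: nome_add [symmetric] nome_diff nome_minus x_def divide_simps)
  moreover have "theta (z + \<tau>) \<tau> = nome (- (z + \<tau>) / 2) * (qpoch (x * p) p * qpoch (1 / x) p)"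
    by (simp add: theta_def nome_add nome_minus x_def p_def inverse_eq_divide)
  moreover have "theta z \<tau> = nome (- z / 2) * (qpoch x p * qpoch (p / x) p)"
    by (simp add: theta_def nome_diff x_def p_def)
  ultimately show ?thesis using 1 by simp
qed

lemma theta_add_int: "theta (z + of_int n) \<tau> = (-1) powi n * theta z \<tau>"
proof (induction n rule: int_induct[of _ 0])
  case (step1 i)
  thus ?case using theta_add_1[of "z + of_int i" \<tau>] 
    by (simp add: add_ac power_int_add)
next
  case (step2 i)
  thus ?case using theta_add_1[of "z + of_int (i - 1)" \<tau>] 
    by (simp add: add_ac power_int_diff)
qed auto

lemma theta_add_int_tau:
  assumes "Im \<tau> > 0"
  shows "theta (z + of_int m * \<tau>) \<tau> = (-1) powi m * nome (- of_int m * z - of_int m ^ 2 * \<tau> / 2) * theta z \<tau>"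
proof (induction m rule: int_induct[of _ 0])
  case (step1 i)
  have "theta (z + of_int (i + 1) * \<tau>) \<tau> = theta (z + of_int i * \<tau> + \<tau>) \<tau>"
    by (simp add: algebra_simps)
  also have "\<dots> = - nome (- (z + of_int i * \<tau>) - \<tau> / 2) * theta (z + of_int i * \<tau>) \<tau>"
    by (rule theta_add_tau[OF assms])
  also have "\<dots> = - ((-1) powi i) * (nome (- (z + of_int i * \<tau>) - \<tau> / 2) * nome (- of_int i * z - of_int i ^ 2 * \<tau> / 2)) * theta z \<tau>"
    by (simp add: step1)
  also have "- ((-1) powi i) = ((-1) powi (i + 1) :: complex)"
    by (simp add: power_int_add)
  also have "nome (- (z + of_int i * \<tau>) - \<tau> / 2) * nome (- of_int i * z - of_int i ^ 2 * \<tau> / 2) =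
      nome (- of_int (i + 1) * z - of_int (i + 1) ^ 2 * \<tau> / 2)"
    unfolding nome_add [symmetric]
    by (rule arg_cong[of _ _ nome]) (simp add: field_simps power2_eq_square)
  finally show ?case .
next
  case (step2 i)
  have "nome (- (z + of_int (i - 1) * \<tau>) - \<tau> / 2) * theta (z + of_int (i - 1) * \<tau>) \<tau> = - theta (z + of_int i * \<tau>) \<tau>"
    using theta_add_tau[OF assms, of "z + of_int (i - 1) * \<tau>"] by (simp add: algebra_simps)
  also have "\<dots> = (-1) powi (i - 1) * nome (- of_int i * z - of_int i ^ 2 * \<tau> / 2) * theta z \<tau>"
    by (simp add: step2 power_int_diff)
  also have "- of_int i * z - of_int i ^ 2 * \<tau> / 2 = 
      (- (z + of_int (i - 1) * \<tau>) - \<tau> / 2) + (- of_int (i - 1) * z - of_int (i - 1) ^ 2 * \<tau> / 2)"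
    by (simp add: field_simps power2_eq_square)
  finally show ?case
    unfolding nome_add by simp
qed auto

lemma theta_add_lattice:
  assumes "Im \<tau> > 0"
  shows "theta (z + of_int m * \<tau> + of_int n) \<tau> =
           (-1) powi (m + n) * nome (- of_int m * z - of_int m ^ 2 * \<tau> / 2) * theta z \<tau>"
  unfolding theta_add_int theta_add_int_tau[OF assms] by (simp add: power_int_add)

text \<open>At the origin the factor 1 - \<open>nome w\<close> has a simple zero and the cofactor
  \<open>H\<close> is nonzero. Translation by a lattice vector multiplies \<open>theta\<close> by
  the nowhere vanishing factor \<open>u\<close>, so the other zeros are simple too.\<close>

lemma deriv_theta_nonzero:
  assumes "Im \<tau> > 0" "theta z \<tau> = 0"
  shows "deriv (\<lambda>z. theta z \<tau>) z \<noteq> 0"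
proof -
  note p = norm_nome_less_1[OF assms(1)]
  define H where "H = (\<lambda>w. nome (- w / 2) * qpoch (nome (w + \<tau>)) (nome \<tau>) * qpoch (nome (\<tau> - w)) (nome \<tau>))"
  have H: "H holomorphic_on UNIV" unfolding H_def
    by (intro holomorphic_intros holomorphic_on_qpoch norm_nome_less_1 assms open_UNIV) auto
  have theta_H: "theta w \<tau> = (1 - nome w) * H w" for w
    using qpoch_rec[OF p, of "nome w"] by (simp add: theta_def H_def nome_add)
  have "H 0 \<noteq> 0" using qpoch_nonzero[OF p p] by (simp add: H_def)
  have dtheta: "((\<lambda>w. theta w \<tau>) has_field_derivative - (2 * pi * \<i>) * H 0) (at 0)"
  proof -
    have "(H has_field_derivative deriv H 0) (at 0)"
      using H by (auto intro: holomorphic_derivI)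
    moreover have "((\<lambda>w. 1 - nome w) has_field_derivative - (2 * pi * \<i>)) (at 0)"
      unfolding nome_def by (auto intro!: derivative_eq_intros)
    ultimately show ?thesis
      unfolding theta_H using DERIV_mult by fastforce
  qed
  obtain m n where z: "z = of_int m * \<tau> + of_int n"
    using assms theta_eq_0_iff by blast
  define u where "u = (\<lambda>w. (-1) powi (m + n) * nome (- of_int m * w - of_int m ^ 2 * \<tau> / 2))"
  have "u holomorphic_on UNIV"
    unfolding u_def by (intro holomorphic_intros)
  hence du: "(u has_field_derivative deriv u 0) (at 0)"
    by (auto intro: holomorphic_derivI)
  have "theta 0 \<tau> = 0" using theta_H[of 0] by simp
  hence "((\<lambda>w. u w * theta w \<tau>) has_field_derivative u 0 * (- (2 * pi * \<i>) * H 0)) (at 0)"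
    using DERIV_mult[OF du dtheta] by (simp add: mult_ac)
  also have "(\<lambda>w. u w * theta w \<tau>) = (\<lambda>w. theta (w + z) \<tau>)"
    using theta_add_lattice[OF assms(1)] by (simp add: u_def z add_ac fun_eq_iff)
  finally have "((\<lambda>w. theta w \<tau>) has_field_derivative u 0 * (- (2 * pi * \<i>) * H 0)) (at z)"
    using DERIV_shift[of "\<lambda>w. theta w \<tau>" _ 0 z] by simp
  moreover have "u 0 \<noteq> 0" by (simp add: u_def)
  ultimately show ?thesis
    using \<open>H 0 \<noteq> 0\<close> by (simp add: DERIV_imp_deriv)
qed

section \<open>Modular transformation of the theta function\<close>

lemma denominator_nonzero:
  fixes a b c d :: int
  assumes "a * d - b * c = 1" "Im \<tau> > 0"
  shows "of_int c * \<tau> + of_int d \<noteq> (0 :: complex)"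
proof
  assume *: "of_int c * \<tau> + of_int d = 0"
  hence "Im (of_int c * \<tau> + of_int d) = 0" by simp
  with assms have "c = 0" by simp
  with * assms show False by simp
qed

lemma Im_moebius_pos:
  assumes "a * d - b * c = 1" "Im \<tau> > 0"
  shows "Im (moebius (a, b, c, d) \<tau>) > 0"
proof -
  define J where "J = of_int c * \<tau> + of_int d"
  have "J \<noteq> 0" using denominator_nonzero[OF assms] by (simp add: J_def)
  have "Im (moebius (a, b, c, d) \<tau>) = Im ((of_int a * \<tau> + of_int b) * cnj J) / (norm J)\<^sup>2"
    unfolding moebius_def J_def prod.case by (subst complex_div_cnj) (simp add: Im_divide_of_real flip: of_real_power)
  also have "Im ((of_int a * \<tau> + of_int b) * cnj J) = of_int (a * d - b * c) * Im \<tau>"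
    by (simp add: J_def algebra_simps)
  finally show ?thesis using assms \<open>J \<noteq> 0\<close> by simp
qed

text \<open>The constant \<open>C\<close> depends on \<tau> and the matrix but not on z. Its value,
  which would involve a square root and an eighth root of unity, is left open because only quotients
  of theta values at the same \<tau> are formed later.\<close>

lemma theta_moebius:
  assumes det: "a * d - b * c = 1" and \<tau>: "Im \<tau> > 0"
  obtains C where "C \<noteq> 0"
    "\<And>z. theta (z / (of_int c * \<tau> + of_int d)) (moebius (a, b, c, d) \<tau>) =
            C * nome (of_int c * z\<^sup>2 / (2 * (of_int c * \<tau> + of_int d))) * theta z \<tau>"
proof -
  define J where "J = of_int c * \<tau> + of_int d"
  define \<tau>' where "\<tau>' = moebius (a, b, c, d) \<tau>"
  have J: "J \<noteq> 0" using denominator_nonzero[OF det \<tau>] by (simp add: J_def)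
  have \<tau>': "Im \<tau>' > 0" using Im_moebius_pos[OF det \<tau>] by (simp add: \<tau>'_def)
  have \<tau>'J: "\<tau>' * J = of_int a * \<tau> + of_int b"
    using J by (simp add: \<tau>'_def moebius_def J_def)
  have det': "of_int a * of_int d - of_int b * of_int c = (1 :: complex)"
    using det by (metis of_int_1 of_int_diff of_int_mult)
  \<comment> \<open>Together with the next fact: division by \<open>J\<close> carries the periods 1
    and \<tau> to vectors of the lattice spanned by 1 and \<tau>'.\<close>
  have inv: "1 / J = of_int (- c) * \<tau>' + of_int a"
  proof -
    have "(of_int (- c) * \<tau>' + of_int a) * J = 1"
      using \<tau>'J det' unfolding J_def of_int_minus by algebra
    thus ?thesis using J by (simp add: field_simps)
  qed
  have \<tau>_J: "\<tau> / J = of_int d * \<tau>' + of_int (- b)"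
  proof -
    have "(of_int d * \<tau>' + of_int (- b)) * J = \<tau>"
      using \<tau>'J det' unfolding J_def of_int_minus by algebra
    thus ?thesis using J by (simp add: field_simps)
  qed
  \<comment> \<open>The Gaussian factor offsets the quasi-period factors that \<open>theta\<close>
    acquires over the new lattice.\<close>
  define N where "N = (\<lambda>z. nome (- of_int c * z\<^sup>2 / (2 * J)) * theta (z / J) \<tau>')"
  define D where "D = (\<lambda>z. theta z \<tau>)"
  have holN: "N holomorphic_on UNIV" unfolding N_def
    by (intro holomorphic_intros holomorphic_on_theta \<tau>') (use J in auto)
  have holD: "D holomorphic_on UNIV" unfolding D_def
    by (intro holomorphic_intros holomorphic_on_theta \<tau>) auto
  have zero: "N z = 0 \<longleftrightarrow> D z = 0" for z
  proof -
    have "N z = 0 \<longleftrightarrow> (\<exists>m n. z / J = of_int m * \<tau>' + of_int n)"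
      by (simp add: N_def theta_eq_0_iff[OF \<tau>'])
    also have "\<dots> \<longleftrightarrow> (\<exists>m n. z = of_int m * \<tau> + of_int n)"
    proof safe
      fix m n assume "z / J = of_int m * \<tau>' + of_int n"
      hence "z = of_int m * (\<tau>' * J) + of_int n * J" using J by (simp add: field_simps)
      also have "\<dots> = of_int (m * a + n * c) * \<tau> + of_int (m * b + n * d)"
        unfolding \<tau>'J by (simp add: J_def algebra_simps)
      finally show "\<exists>m n. z = of_int m * \<tau> + of_int n" by blast
    next
      fix m n
      have "(of_int m * \<tau> + of_int n) / J = of_int m * (\<tau> / J) + of_int n * (1 / J)"
        by (simp add: add_divide_distrib)
      also have "\<dots> = of_int (m * d - n * c) * \<tau>' + of_int (n * a - m * b)"
        unfolding \<tau>_J inv by (simp add: algebra_simps)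
      finally show "\<exists>m' n'. (of_int m * \<tau> + of_int n) / J = of_int m' * \<tau>' + of_int n'" by blast
    qed
    also have "\<dots> \<longleftrightarrow> D z = 0" by (simp add: D_def theta_eq_0_iff[OF \<tau>])
    finally show ?thesis .
  qed
  have sgn: "norm ((-1) powi n :: complex) = 1" for n by (simp add: norm_power_int)
  have half: "norm (nome (of_int n / 2)) = 1" for n by (simp add: nome_of_int_half sgn)
  have per1: "norm (N (z + 1) / D (z + 1)) = norm (N z / D z)" for z
  proof -
    have "theta ((z + 1) / J) \<tau>' = theta (z / J + of_int (- c) * \<tau>' + of_int a) \<tau>'"
      by (simp only: add_divide_distrib inv add.assoc)
    also have "\<dots> = (-1) powi (- c + a) * nome (- of_int (- c) * (z / J) - of_int (- c) ^ 2 * \<tau>' / 2) * theta (z / J) \<tau>'"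
      by (rule theta_add_lattice[OF \<tau>'])
    finally have "N (z + 1) = (-1) powi (- c + a) * (nome (- of_int c * (z + 1)\<^sup>2 / (2 * J)) *
        nome (- of_int (- c) * (z / J) - of_int (- c) ^ 2 * \<tau>' / 2)) * theta (z / J) \<tau>'"
      by (simp add: N_def)
    \<comment> \<open>The Gaussian and quasi-period exponents cancel up to the half-integer -ac/2,
      which has no effect on the modulus.\<close>
    also have "nome (- of_int c * (z + 1)\<^sup>2 / (2 * J)) * nome (- of_int (- c) * (z / J) - of_int (- c) ^ 2 * \<tau>' / 2)
       = nome (of_int (- (a * c)) / 2) * nome (- of_int c * z\<^sup>2 / (2 * J))"
    proof -
      have "- of_int c * (z + 1)\<^sup>2 / (2 * J) = - of_int c * z\<^sup>2 / (2 * J) - of_int c * (z / J) - of_int c / 2 * (1 / J)"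
        using J by (simp add: field_simps power2_eq_square)
      hence "- of_int c * (z + 1)\<^sup>2 / (2 * J) + (- of_int (- c) * (z / J) - of_int (- c) ^ 2 * \<tau>' / 2) =
         of_int (- (a * c)) / 2 + (- of_int c * z\<^sup>2 / (2 * J))"
        unfolding inv by (simp add: algebra_simps power2_eq_square)
      thus ?thesis by (simp only: nome_add [symmetric])
    qed
    finally have "norm (N (z + 1)) = norm (N z)"
      by (simp only: norm_mult sgn half N_def mult_1)
    thus ?thesis by (simp add: D_def theta_add_1 norm_divide)
  qed
  have per2: "norm (N (z + \<tau>) / D (z + \<tau>)) = norm (N z / D z)" for z
  proof -
    have "theta ((z + \<tau>) / J) \<tau>' = theta (z / J + of_int d * \<tau>' + of_int (- b)) \<tau>'"
      by (simp only: add_divide_distrib \<tau>_J add.assoc)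
    also have "\<dots> = (-1) powi (d + - b) * nome (- of_int d * (z / J) - of_int d ^ 2 * \<tau>' / 2) * theta (z / J) \<tau>'"
      by (rule theta_add_lattice[OF \<tau>'])
    finally have "N (z + \<tau>) = (-1) powi (d + - b) * (nome (- of_int c * (z + \<tau>)\<^sup>2 / (2 * J)) *
        nome (- of_int d * (z / J) - of_int d ^ 2 * \<tau>' / 2)) * theta (z / J) \<tau>'"
      by (simp add: N_def)
    \<comment> \<open>What survives besides a sign is \<open>nome (- z - \<tau> / 2)\<close>, the
      very factor that \<open>D\<close> acquires under this shift.\<close>
    also have "nome (- of_int c * (z + \<tau>)\<^sup>2 / (2 * J)) * nome (- of_int d * (z / J) - of_int d ^ 2 * \<tau>' / 2)
       = nome (of_int (- (b * d)) / 2) * nome (- z - \<tau> / 2) * nome (- of_int c * z\<^sup>2 / (2 * J))"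
    proof -
      have dJ: "of_int d = J - of_int c * \<tau>" by (simp add: J_def)
      have 1: "- of_int c * (z + \<tau>)\<^sup>2 / (2 * J) - of_int d * (z / J) = 
          - of_int c * z\<^sup>2 / (2 * J) - z - of_int c * \<tau> / 2 * (\<tau> / J)"
        unfolding dJ using J by (simp add: field_simps power2_eq_square)
      have 2: "- of_int c * \<tau> / 2 * (\<tau> / J) - of_int d ^ 2 * \<tau>' / 2 = of_int (- (b * d)) / 2 - \<tau> / 2"
      proof -
        have "of_int c * \<tau> * (\<tau> / J) + of_int d ^ 2 * \<tau>' = of_int (b * d) + \<tau>"
        proof -
          have "of_int c * \<tau> * (\<tau> / J) = (J - of_int d) * (of_int d * \<tau>' + of_int (- b))"
            unfolding \<tau>_J by (simp add: J_def)
          also have "\<dots> = of_int d * (\<tau>' * J) - of_int b * J - of_int d ^ 2 * \<tau>' + of_int (b * d)"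
            by (simp add: algebra_simps power2_eq_square)
          also have "of_int d * (\<tau>' * J) - of_int b * J = \<tau>"
            using \<tau>'J det' unfolding J_def by algebra
          finally show ?thesis by simp
        qed
        moreover have "- of_int c * \<tau> / 2 * (\<tau> / J) - of_int d ^ 2 * \<tau>' / 2 =
            - (of_int c * \<tau> * (\<tau> / J) + of_int d ^ 2 * \<tau>') / 2"
          by (simp add: add_divide_distrib diff_divide_distrib)
        ultimately show ?thesis by (simp add: diff_divide_distrib)
      qed
      have "- of_int c * (z + \<tau>)\<^sup>2 / (2 * J) + (- of_int d * (z / J) - of_int d ^ 2 * \<tau>' / 2) =
         of_int (- (b * d)) / 2 + (- z - \<tau> / 2) + (- of_int c * z\<^sup>2 / (2 * J))"
        using 1 2 by algebra
      thus ?thesis by (simp only: nome_add [symmetric])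
    qed
    finally have "norm (N (z + \<tau>)) = norm (nome (- z - \<tau> / 2)) * norm (N z)"
      by (simp only: norm_mult sgn half N_def mult_1 mult.assoc)
    moreover have "norm (D (z + \<tau>)) = norm (nome (- z - \<tau> / 2)) * norm (D z)"
      by (simp add: D_def theta_add_tau[OF \<tau>] norm_mult)
    ultimately show ?thesis by (simp add: norm_divide)
  qed
  have zeros: "N z = 0 \<and> deriv D z \<noteq> 0" if "D z = 0" for z
    using that zero[of z] deriv_theta_nonzero[OF \<tau>, of z] by (simp add: D_def)
  obtain C where C: "\<And>z. N z = C * D z"
    using entire_quotient_constant[OF holN holD \<tau> zeros per1 per2] by blast
  \<comment> \<open>The point 1/2 lies outside the lattice, so neither \<open>N\<close> nor
    \<open>D\<close> vanishes there, and \<open>C\<close> cannot be 0.\<close>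
  have "D (1/2) \<noteq> 0"
  proof
    assume "D (1/2) = 0"
    then obtain m n where mn: "1/2 = of_int m * \<tau> + of_int n"
      using theta_eq_0_iff[OF \<tau>] by (auto simp: D_def)
    from arg_cong[OF mn, of Im] \<tau> have "m = 0" by simp
    with mn have "2 * complex_of_int n = 1" by (simp add: mult.commute)
    hence "complex_of_int (2 * n) = of_int 1" by simp
    hence "2 * n = 1" by (simp only: of_int_eq_iff)
    thus False by presburger
  qed
  with zero[of "1/2"] C[of "1/2"] have "C \<noteq> 0" by auto
  moreover have "theta (z / J) \<tau>' = C * nome (of_int c * z\<^sup>2 / (2 * J)) * theta z \<tau>" for z
  proof -
    have "nome (of_int c * z\<^sup>2 / (2 * J)) * N z = theta (z / J) \<tau>'"
      by (simp add: N_def nome_minus)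
    thus ?thesis using C[of z] by (simp add: D_def mult_ac)
  qed
  ultimately show ?thesis
    unfolding J_def \<tau>'_def by (rule that)
qed

section \<open>The quotients g1 and g2\<close>

text \<open>The factor \<i> cancels \<open>nome (- 1 / 4)\<close> = -\<i>, which the shift of z by
  1/2 produces in the prefactor of the numerator.\<close>

definition theta_quot :: "int \<Rightarrow> complex \<Rightarrow> complex" where
  "theta_quot k \<tau> = \<i> * theta (of_int k * \<tau> / 5 + 1 / 2) \<tau> / theta (of_int k * \<tau> / 5) \<tau>"

lemma theta_quot_conv_qpoch:
  "theta_quot k (5 * \<tau>) =
     (qpoch (- (nome \<tau> powi k)) (nome \<tau> ^ 5) * qpoch (- (nome \<tau> powi (5 - k))) (nome \<tau> ^ 5)) /
     (qpoch (nome \<tau> powi k) (nome \<tau> ^ 5) * qpoch (nome \<tau> powi (5 - k)) (nome \<tau> ^ 5))"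
proof -
  define z where "z = of_int k * \<tau>"
  have q: "nome z = nome \<tau> powi k" "nome (5 * \<tau> - z) = nome \<tau> powi (5 - k)" "nome (5 * \<tau>) = nome \<tau> ^ 5"
    using nome_of_int_mult[of k \<tau>] nome_of_int_mult[of "5 - k" \<tau>] nome_of_nat_mult[of 5 \<tau>]
    by (simp_all add: z_def algebra_simps)
  have "nome (- 1 / 4) = - \<i>"
    using cis_minus_pi_half by (simp add: nome_def cis_conv_exp mult.commute)
  hence "nome (- (z + 1 / 2) / 2) = - \<i> * nome (- z / 2)"
    using nome_add[of "- z / 2" "- 1 / 4"] by (simp add: diff_divide_distrib mult.commute)
  moreover have "nome (z + 1 / 2) = - nome z" by (simp add: nome_add nome_half)
  moreover have "nome (5 * \<tau> - (z + 1 / 2)) = - nome (5 * \<tau> - z)"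
    using nome_diff[of "5 * \<tau> - z" "1/2"] by (simp add: nome_half algebra_simps)
  ultimately have "theta_quot k (5 * \<tau>) =
     (qpoch (- nome z) (nome (5 * \<tau>)) * qpoch (- nome (5 * \<tau> - z)) (nome (5 * \<tau>))) /
     (qpoch (nome z) (nome (5 * \<tau>)) * qpoch (nome (5 * \<tau> - z)) (nome (5 * \<tau>)))"
    by (simp add: theta_quot_def theta_def z_def mult.assoc)
  thus ?thesis unfolding q .
qed

lemma g1_conv_theta_quot: "g1 \<tau> = theta_quot 1 (5 * \<tau>)"
  by (simp add: theta_quot_conv_qpoch g1_def Let_def)

lemma g2_conv_theta_quot: "g2 \<tau> = theta_quot 2 (5 * \<tau>)"
  by (simp add: theta_quot_conv_qpoch g2_def Let_def)

section \<open>Transformation of the theta quotients\<close>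

text \<open>Numerator and denominator carry the same constant from \<open>theta_moebius\<close>, so
  it cancels. The Gaussian exponents differ by c ((z + J/2)^2 - z^2) / (2J) = c (z/2 + J/8), which
  is affine in \<open>T\<close>: no division by \<open>J\<close> remains.\<close>

lemma theta_quot_moebius:
  fixes a b c d k :: int
  assumes det: "a * d - b * c = 1" and T: "Im T > 0"
  defines "J \<equiv> of_int c * T + of_int d" and "z \<equiv> of_int k * (of_int a * T + of_int b) / 5"
  shows "theta_quot k (moebius (a, b, c, d) T) =
           \<i> * nome (of_int c * (z / 2 + J / 8)) * theta (z + J / 2) T / theta z T"
proof -
  have J: "J \<noteq> 0" using denominator_nonzero[OF det T] by (simp add: J_def)
  obtain C where C: "C \<noteq> 0" "\<And>w. theta (w / J) (moebius (a, b, c, d) T) =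
            C * nome (of_int c * w\<^sup>2 / (2 * J)) * theta w T"
    using theta_moebius[OF det T] unfolding J_def by metis
  have "of_int k * moebius (a, b, c, d) T / 5 = z / J"
    by (simp add: z_def moebius_def J_def)
  moreover from this have "of_int k * moebius (a, b, c, d) T / 5 + 1 / 2 = (z + J / 2) / J"
    using J by (simp add: field_simps)
  ultimately have "theta_quot k (moebius (a, b, c, d) T) =
      \<i> * (nome (of_int c * (z + J / 2)\<^sup>2 / (2 * J)) / nome (of_int c * z\<^sup>2 / (2 * J))) *
      theta (z + J / 2) T / theta z T"
    using C(1) by (simp add: theta_quot_def C(2))
  also have "nome (of_int c * (z + J / 2)\<^sup>2 / (2 * J)) / nome (of_int c * z\<^sup>2 / (2 * J)) =
      nome (of_int c * (z / 2 + J / 8))"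
    unfolding nome_diff [symmetric]
    by (rule arg_cong[of _ _ nome]) (use J in \<open>simp add: field_simps power2_eq_square\<close>)
  finally show ?thesis .
qed

text \<open>The shape of the matrix makes the new point z' congruent to z, and \<open>J / 2\<close>
  congruent to 1/2, modulo the lattice, so both theta arguments return to the original ones by
  lattice translations.\<close>

lemma theta_quot_multiplier:
  fixes a b c d k :: int
  assumes det: "(1 + 5 * a) * (1 + 2 * d) - 5 * b * (2 * c) = 1" and T: "Im T > 0"
  shows "theta_quot k (moebius (1 + 5 * a, 5 * b, 2 * c, 1 + 2 * d) T) =
           nome (of_int (c * (1 + 2 * d)) / 4) * (-1) powi (k * a + d) * theta_quot k T"
proof -
  define z where "z = of_int k * T / 5"
  define J where "J = of_int (2 * c) * T + of_int (1 + 2 * d)"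
  define z' where "z' = of_int k * (of_int (1 + 5 * a) * T + of_int (5 * b)) / 5"
  have z': "z' = z + of_int (k * a) * T + of_int (k * b)"
    by (simp add: z'_def z_def field_simps)
  have zJ: "z' + J / 2 = (z + 1 / 2) + of_int (k * a + c) * T + of_int (k * b + d)"
    by (simp add: z' J_def field_simps)
  define x0 where "x0 = - of_int (k * a) * z - of_int (k * a) ^ 2 * T / 2"
  define x1 where "x1 = - of_int (k * a + c) * (z + 1 / 2) - of_int (k * a + c) ^ 2 * T / 2"
  define x2 where "x2 = of_int (2 * c) * (z' / 2 + J / 8)"
  have *: "theta_quot k (moebius (1 + 5 * a, 5 * b, 2 * c, 1 + 2 * d) T) =
     \<i> * nome x2 * ((-1) powi (k * a + c + (k * b + d)) * nome x1 * theta (z + 1 / 2) T) /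
       ((-1) powi (k * a + k * b) * nome x0 * theta z T)"
  proof -
    have "theta (z' + J / 2) T = (-1) powi (k * a + c + (k * b + d)) * nome x1 * theta (z + 1 / 2) T"
      unfolding zJ x1_def by (rule theta_add_lattice[OF T])
    moreover have "theta z' T = (-1) powi (k * a + k * b) * nome x0 * theta z T"
      unfolding z' x0_def by (rule theta_add_lattice[OF T])
    ultimately show ?thesis
      unfolding theta_quot_moebius[OF det T] J_def [symmetric] z'_def [symmetric] x2_def [symmetric]
      by (simp only:)
  qed
  \<comment> \<open>All terms in \<open>T\<close> and z cancel. The integer ckb is invisible to
    \<open>nome\<close>, and the half-integer yields a sign.\<close>
  have "x2 + x1 - x0 = of_int (c * k * b) + of_int (c * (1 + 2 * d)) / 4 - of_int (k * a + c) / 2"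
    by (simp add: x2_def x1_def x0_def z' J_def field_simps power2_eq_square)
  hence "nome (x2 + x1 - x0) = nome (of_int (c * (1 + 2 * d)) / 4) / (-1) powi (k * a + c)"
    by (simp only: nome_add nome_diff nome_of_int nome_of_int_half mult_1)
  hence x: "nome x2 * nome x1 / nome x0 = nome (of_int (c * (1 + 2 * d)) / 4) / (-1) powi (k * a + c)"
    by (simp only: nome_add nome_diff)
  \<comment> \<open>Only the parities of the exponents matter.\<close>
  have sgn: "(-1) powi (k * a + c + (k * b + d)) / (-1) powi (k * a + k * b) / (-1) powi (k * a + c) =
        ((-1) powi (k * a + d) :: complex)"
    by (auto simp: power_int_minus_left)
  have "theta_quot k (moebius (1 + 5 * a, 5 * b, 2 * c, 1 + 2 * d) T) =
     (nome x2 * nome x1 / nome x0) * ((-1) powi (k * a + c + (k * b + d)) / (-1) powi (k * a + k * b)) *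
      theta_quot k T"
    unfolding * by (simp add: theta_quot_def z_def mult_ac)
  also have "\<dots> = nome (of_int (c * (1 + 2 * d)) / 4) * 
      ((-1) powi (k * a + c + (k * b + d)) / (-1) powi (k * a + k * b) / (-1) powi (k * a + c)) *
      theta_quot k T"
    unfolding x by simp
  finally show ?thesis unfolding sgn .
qed

text \<open>Conjugation by diag(5, 1) turns (a, b; c, d) into (a, 5b; c/5, d), which for a matrix in
  \<open>Gamma1 10\<close> has the shape that \<open>theta_quot_multiplier\<close> requires. The
  multiplier is a power of \<i> times a sign.\<close>

lemma Gamma1_10_multiplier:
  assumes "\<gamma> \<in> Gamma1 10" "Im \<tau> > 0"
  obtains \<epsilon> where "theta_quot k (5 * moebius \<gamma> \<tau>) = \<epsilon> * theta_quot k (5 * \<tau>)" "\<epsilon> ^ 4 = 1"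
    "\<gamma> \<in> Gamma1 40 \<Longrightarrow> \<epsilon> = 1"
proof -
  obtain a b c d where \<gamma>: "\<gamma> = (a, b, c, d)" by (cases \<gamma>)
  have det: "a * d - b * c = 1" and "a mod 10 = 1" "d mod 10 = 1" "10 dvd c"
    using assms by (auto simp: \<gamma> Gamma1_def)
  define a' c' d' where "a' = a div 5" and "c' = c div 10" and "d' = d div 2"
  have a: "a = 1 + 5 * a'" using \<open>a mod 10 = 1\<close> unfolding a'_def by presburger
  have c: "c = 10 * c'" using \<open>10 dvd c\<close> unfolding c'_def by presburger
  have d: "d = 1 + 2 * d'" using \<open>d mod 10 = 1\<close> unfolding d'_def by presburger
  have T: "Im (5 * \<tau>) > 0" using assms by simp
  have det': "(1 + 5 * a') * (1 + 2 * d') - 5 * b * (2 * c') = 1"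
    using det by (simp add: a c d)
  define \<epsilon> where "\<epsilon> = nome (of_int (c' * (1 + 2 * d')) / 4) * (-1) powi (k * a' + d')"
  have "5 * moebius \<gamma> \<tau> = moebius (1 + 5 * a', 5 * b, 2 * c', 1 + 2 * d') (5 * \<tau>)"
    by (simp add: \<gamma> a c d moebius_def algebra_simps)
  hence "theta_quot k (5 * moebius \<gamma> \<tau>) = \<epsilon> * theta_quot k (5 * \<tau>)"
    using theta_quot_multiplier[OF det' T] by (simp add: \<epsilon>_def)
  moreover have "\<epsilon> ^ 4 = 1"
  proof -
    have "nome (of_int (c' * (1 + 2 * d')) / 4) ^ 4 = nome (of_int (c' * (1 + 2 * d')))"
      by (simp flip: nome_of_nat_mult)
    moreover have "((-1) powi (k * a' + d') :: complex) ^ 4 = 1"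
      by (auto simp: power_int_minus_left)
    ultimately show ?thesis by (simp only: \<epsilon>_def power_mult_distrib nome_of_int mult_1)
  qed
  moreover have "\<epsilon> = 1" if "\<gamma> \<in> Gamma1 40"
  proof -
    have "a mod 40 = 1" "d mod 40 = 1" "40 dvd c" using that by (auto simp: \<gamma> Gamma1_def)
    \<comment> \<open>Evenness of a' and d' removes the sign, and divisibility of c' by 4 removes
      the power of \<i>.\<close>
    hence "even a'" "even d'" "4 dvd c'" unfolding a c d by presburger+
    then obtain m where "c' = 4 * m" by blast
    hence "nome (of_int (c' * (1 + 2 * d')) / 4) = nome (of_int (m * (1 + 2 * d')))" by simp
    thus ?thesis using \<open>even a'\<close> \<open>even d'\<close>
      by (simp only: \<epsilon>_def nome_of_int) (simp add: power_int_minus_left)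
  qed
  ultimately show ?thesis by (rule that)
qed

section \<open>Expansions at the cusps\<close>

lemma nome_40: "nome (of_int n * T / 40) = nome (T / 40) powi n"
  using nome_of_int_mult[of n "T / 40"] by simp

text \<open>A translation by a multiple of \<open>T\<close> reduces m modulo 10. Both products then
  involve only nonnegative powers of s = \<open>nome (T / 40)\<close> and are holomorphic near s =
  0; everything else is a constant times an integral power of s.\<close>

lemma theta_cusp_expansion:
  fixes m :: int and v :: complex
  obtains K where "K meromorphic_on {0}"
    "\<And>T. Im T > 0 \<Longrightarrow> theta (of_int m * T / 10 + v) T = K (nome (T / 40))"
proof -
  define j l where "j = m div 10" and "l = nat (m mod 10)"
  \<comment> \<open>The bound on \<open>l\<close> also keeps the natural-number difference
    \<open>40 - 4 * l\<close> from being truncated.\<close>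
  have l: "l < 10" and m: "m = 10 * j + int l" by (auto simp: j_def l_def nat_less_iff)
  define P where "P = (\<lambda>s. qpoch (s ^ (4 * l) * nome v) (s ^ 40) * qpoch (s ^ (40 - 4 * l) * nome (- v)) (s ^ 40))"
  define K where "K = (\<lambda>s. (-1) powi j * nome (- of_int j * v - v / 2) *
      s powi (- 4 * j * int l - 20 * j\<^sup>2 - 2 * int l) * P s)"
  have "P holomorphic_on ball 0 1" unfolding P_def
    by (intro holomorphic_intros holomorphic_on_qpoch open_ball)
       (auto simp: norm_power power_less_one_iff)
  hence "P analytic_on {0}"
    by (auto simp: analytic_at intro!: exI[of _ "ball 0 1"])
  hence "K meromorphic_on {0}"
    unfolding K_def by (intro meromorphic_intros analytic_on_imp_meromorphic_on) auto
  moreover have "theta (of_int m * T / 10 + v) T = K (nome (T / 40))" if T: "Im T > 0" for T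
  proof -
    define s where "s = nome (T / 40)"
    define z where "z = of_nat l * T / 10 + v"
    have "of_int m * T / 10 + v = z + of_int j * T"
      by (simp add: m z_def field_simps)
    hence "theta (of_int m * T / 10 + v) T =
        (-1) powi j * nome (- of_int j * z - of_int j ^ 2 * T / 2) * theta z T"
      using theta_add_int_tau[OF T] by simp
    also have "theta z T = nome (- z / 2) * P s"
    proof -
      have "nome T = s ^ 40"
        using nome_of_nat_mult[of 40 "T / 40"] by (simp add: s_def)
      moreover have "nome z = s ^ (4 * l) * nome v"
        using nome_of_nat_mult[of "4 * l" "T / 40"] by (simp add: s_def z_def nome_add mult.commute)
      moreover have "nome (T - z) = s ^ (40 - 4 * l) * nome (- v)"
      proof -
        have "T - z = of_nat (40 - 4 * l) * (T / 40) + - v"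
          using l by (simp add: z_def of_nat_diff field_simps)
        thus ?thesis by (simp only: nome_add nome_of_nat_mult s_def)
      qed
      ultimately show ?thesis by (simp add: theta_def P_def)
    qed
    also have "(-1) powi j * nome (- of_int j * z - of_int j ^ 2 * T / 2) * (nome (- z / 2) * P s) =
        (-1) powi j * nome (- of_int j * z - of_int j ^ 2 * T / 2 + - z / 2) * P s"
      unfolding nome_add by simp
    also have "- of_int j * z - of_int j ^ 2 * T / 2 + - z / 2 =
        (- of_int j * v - v / 2) + of_int (- 4 * j * int l - 20 * j\<^sup>2 - 2 * int l) * T / 40"
      by (simp add: z_def field_simps)
    finally show ?thesis
      unfolding nome_add nome_40 K_def s_def [symmetric] by simp
  qed
  ultimately show ?thesis by (rule that)
qed

text \<open>Every argument in \<open>theta_quot_moebius\<close> is affine in \<open>T\<close>. The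
  denominator 40 accommodates both the tenths in the theta arguments and the term c^2 T / 8 of the
  exponent.\<close>

lemma theta_quot_cusp_expansion:
  assumes det: "a * d - b * c = 1"
  obtains K where "K meromorphic_on {0}"
    "\<And>T. Im T > 0 \<Longrightarrow> theta_quot k (moebius (a, b, c, d) T) = K (nome (T / 40))"
proof -
  obtain K1 where K1: "K1 meromorphic_on {0}"
    "\<And>T. Im T > 0 \<Longrightarrow> theta (of_int (2 * k * a + 5 * c) * T / 10 + (of_int (k * b) / 5 + of_int d / 2)) T = K1 (nome (T / 40))"
    using theta_cusp_expansion by blast
  obtain K0 where K0: "K0 meromorphic_on {0}"
    "\<And>T. Im T > 0 \<Longrightarrow> theta (of_int (2 * k * a) * T / 10 + of_int (k * b) / 5) T = K0 (nome (T / 40))"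
    using theta_cusp_expansion by blast
  define x where "x = complex_of_int c * (of_int (k * b) / 10 + of_int d / 8)"
  define K where "K = (\<lambda>s. \<i> * (s powi (4 * k * a * c + 5 * c\<^sup>2) * nome x) * K1 s / K0 s)"
  have "K meromorphic_on {0}"
    unfolding K_def by (intro meromorphic_intros K1 K0)
  moreover have "theta_quot k (moebius (a, b, c, d) T) = K (nome (T / 40))" if T: "Im T > 0" for T
  proof -
    define J z where "J = of_int c * T + of_int d" and "z = of_int k * (of_int a * T + of_int b) / 5"
    have "z = of_int (2 * k * a) * T / 10 + of_int (k * b) / 5"
      by (simp add: z_def field_simps)
    moreover have "z + J / 2 = of_int (2 * k * a + 5 * c) * T / 10 + (of_int (k * b) / 5 + of_int d / 2)"
      by (simp add: z_def J_def field_simps)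
    moreover have "of_int c * (z / 2 + J / 8) = of_int (4 * k * a * c + 5 * c\<^sup>2) * T / 40 + x"
      by (simp add: z_def J_def x_def field_simps power2_eq_square)
    ultimately show ?thesis
      unfolding theta_quot_moebius[OF det T] J_def [symmetric] z_def [symmetric]
      by (simp only: K1(2)[OF T] K0(2)[OF T] K_def nome_add nome_40)
  qed
  ultimately show ?thesis by (rule that)
qed

text \<open>The product of diag(5, 1) with the given matrix has determinant 5, hence equals a matrix
  of determinant 1 times an upper triangular one: (5, 0; 0, 1) if 5 divides c, and (1, B; 0, 5)
  otherwise. Dividing the resulting \<open>T\<close> by 40 gives the widths h = 8 and h =
  200.\<close>

lemma five_moebius_factorisation:
  assumes det: "a * d - b * c = 1"
  obtains a' b' c' d' h B where "a' * d' - b' * c' = 1" "h > (0::nat)"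
    "\<And>\<tau>. Im \<tau> > 0 \<Longrightarrow> \<exists>T. Im T > 0 \<and> 5 * moebius (a, b, c, d) \<tau> = moebius (a', b', c', d') T \<and>
            T / 40 = B + \<tau> / of_nat h"
proof (cases "5 dvd c")
  case True
  then obtain c' where c: "c = 5 * c'" by blast
  show ?thesis
  proof (rule that)
    show "a * d - (5 * b) * c' = 1" using det by (simp add: c)
    fix \<tau> :: complex assume "Im \<tau> > 0"
    thus "\<exists>T. Im T > 0 \<and> 5 * moebius (a, b, c, d) \<tau> = moebius (a, 5 * b, c', d) T \<and>
            T / 40 = 0 + \<tau> / of_nat 8"
      by (intro exI[of _ "5 * \<tau>"]) (simp add: moebius_def c algebra_simps)
  qed simp
next
  case False
  hence "gcd c 5 = 1"
    using prime_imp_coprime[of 5 c] by (simp add: coprime_iff_gcd_eq_1 gcd.commute)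
  then obtain u v where uv: "u * c + v * 5 = 1" using bezout_int[of c 5] by metis
  \<comment> \<open>Multiplying the Bezout identity by d gives d = cB + 5y, so B solves cB = d
    modulo 5.\<close>
  define y where "y = v * d"
  define B where "B = u * d"
  have d: "d = c * B + 5 * y" using uv unfolding B_def y_def by algebra
  show ?thesis
  proof (rule that)
    show "(5 * a) * y - (b - a * B) * c = 1" using det by (simp add: d algebra_simps)
    fix \<tau> :: complex assume "Im \<tau> > 0"
    have 1: "of_int c * ((\<tau> + of_int B) / 5) + of_int y = (of_int c * \<tau> + of_int d) / 5"
      by (simp add: d field_simps)
    have 2: "of_int (5 * a) * ((\<tau> + of_int B) / 5) + of_int (b - a * B) = of_int a * \<tau> + of_int b"
      by (simp add: field_simps)
    have "5 * moebius (a, b, c, d) \<tau> = moebius (5 * a, b - a * B, c, y) ((\<tau> + of_int B) / 5)"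
      unfolding moebius_def prod.case 1 2 by simp
    thus "\<exists>T. Im T > 0 \<and> 5 * moebius (a, b, c, d) \<tau> = moebius (5 * a, b - a * B, c, y) T \<and>
            T / 40 = of_int B / 200 + \<tau> / of_nat 200"
      using \<open>Im \<tau> > 0\<close>
      by (intro exI[of _ "(\<tau> + of_int B) / 5"]) (simp add: field_simps)
  qed simp
qed

section \<open>Modularity of the four functions\<close>

text \<open>One criterion serves all four functions, with R(x) = x^4 for the powers and R(x) = (x -
  1)/(x + 1) for \<open>T1\<close> and \<open>T2\<close>. The cusp condition follows by composing R
  with the expansion of the theta quotient.\<close>

lemma modular_function_on_theta_quotI:
  assumes f: "\<And>\<tau>. Im \<tau> > 0 \<Longrightarrow> f \<tau> = R (theta_quot k (5 * \<tau>))"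
    and R: "\<And>F A. F meromorphic_on A \<Longrightarrow> (\<lambda>x. R (F x)) meromorphic_on A"
    and mero: "f meromorphic_on upper_half_plane"
    and \<Gamma>: "\<Gamma> \<subseteq> SL2Z"
    and invar: "\<And>\<gamma> \<tau>. \<gamma> \<in> \<Gamma> \<Longrightarrow> Im \<tau> > 0 \<Longrightarrow>
                  R (theta_quot k (5 * moebius \<gamma> \<tau>)) = R (theta_quot k (5 * \<tau>))"
  shows "modular_function_on f \<Gamma>"
  unfolding modular_function_on_def
proof (intro conjI ballI mero)
  have H: "open upper_half_plane"
    by (simp add: upper_half_plane_def open_halfspace_Im_gt)
  have pos: "Im (moebius \<gamma> \<tau>) > 0" if "\<gamma> \<in> SL2Z" "Im \<tau> > 0" for \<gamma> \<tau>
    using that Im_moebius_pos by (auto simp: SL2Z_def)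
  show "eventually (\<lambda>\<tau>. f (moebius \<gamma> \<tau>) = f \<tau>) (at z)"
    if "\<gamma> \<in> \<Gamma>" "z \<in> upper_half_plane" for \<gamma> z
    using eventually_at_in_open'[OF H that(2)]
  proof eventually_elim
    case (elim \<tau>)
    hence "Im \<tau> > 0" by (simp add: upper_half_plane_def)
    thus ?case using pos[of \<gamma> \<tau>] that \<Gamma> by (auto simp: f invar)
  qed
  show "meromorphic_at_cusps f"
    unfolding meromorphic_at_cusps_def
  proof
    fix \<sigma> assume \<sigma>: "\<sigma> \<in> SL2Z"
    then obtain a b c d where [simp]: "\<sigma> = (a, b, c, d)" and det: "a * d - b * c = 1"
      by (auto simp: SL2Z_def)
    obtain a' b' c' d' h B where det': "a' * d' - b' * c' = 1" and h: "h > (0::nat)" and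
      T: "\<And>\<tau>. Im \<tau> > 0 \<Longrightarrow> \<exists>T. Im T > 0 \<and> 5 * moebius \<sigma> \<tau> = moebius (a', b', c', d') T \<and>
            T / 40 = B + \<tau> / of_nat h"
      using five_moebius_factorisation[OF det] unfolding \<open>\<sigma> = _\<close> by metis
    obtain K where K: "K meromorphic_on {0}"
      "\<And>T. Im T > 0 \<Longrightarrow> theta_quot k (moebius (a', b', c', d') T) = K (nome (T / 40))"
      using theta_quot_cusp_expansion[OF det'] by blast
    \<comment> \<open>Since T/40 = B + \<tau>/h, the expansion variable is \<open>nome B\<close>
      times the local parameter at the cusp.\<close>
    define G where "G = (\<lambda>t. R (K (nome B * t)))"
    have "(\<lambda>t. K (nome B * t)) meromorphic_on {0}"
      by (rule meromorphic_on_compose[OF K(1)]) (auto intro!: analytic_intros)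
    hence "G meromorphic_on {0}" unfolding G_def by (rule R)
    moreover have "f (moebius \<sigma> \<tau>) = G (exp (2 * pi * \<i> * \<tau> / of_nat h))" if \<tau>: "Im \<tau> > 0" for \<tau>
    proof -
      obtain T' where T': "Im T' > 0" "5 * moebius \<sigma> \<tau> = moebius (a', b', c', d') T'"
          "T' / 40 = B + \<tau> / of_nat h"
        using T[OF \<tau>] by blast
      have "f (moebius \<sigma> \<tau>) = R (K (nome (T' / 40)))"
        using f[OF pos[OF \<sigma> \<tau>]] K(2)[OF T'(1)] T'(2) by simp
      also have "nome (T' / 40) = nome B * exp (2 * pi * \<i> * \<tau> / of_nat h)"
        by (simp add: T'(3) nome_add) (simp add: nome_def)
      finally show ?thesis by (simp add: G_def)
    qed
    ultimately show "\<exists>h>0. \<exists>G y0. G meromorphic_on {0} \<and>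
        (\<forall>\<tau>. Im \<tau> > y0 \<longrightarrow> f (moebius \<sigma> \<tau>) = G (exp (2 * pi * \<i> * \<tau> / of_nat h)))"
      using h by blast
  qed
qed

lemma meromorphic_on_qpoch_nome:
  "(\<lambda>\<tau>. qpoch (nome \<tau> ^ n) (nome \<tau> ^ 5)) meromorphic_on upper_half_plane"
  "(\<lambda>\<tau>. qpoch (- (nome \<tau> ^ n)) (nome \<tau> ^ 5)) meromorphic_on upper_half_plane"
proof -
  have H: "open upper_half_plane"
    by (simp add: upper_half_plane_def open_halfspace_Im_gt)
  have *: "norm (nome \<tau> ^ 5) < 1" if "\<tau> \<in> upper_half_plane" for \<tau>
    using norm_nome_less_1[of \<tau>] that
    by (simp add: upper_half_plane_def norm_power power_less_one_iff)
  show "(\<lambda>\<tau>. qpoch (nome \<tau> ^ n) (nome \<tau> ^ 5)) meromorphic_on upper_half_plane"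
    "(\<lambda>\<tau>. qpoch (- (nome \<tau> ^ n)) (nome \<tau> ^ 5)) meromorphic_on upper_half_plane"
    by (rule analytic_on_imp_meromorphic_on, subst analytic_on_open[OF H],
        intro holomorphic_intros holomorphic_on_qpoch H * refl, assumption?)+
qed

lemma meromorphic_g1: "g1 meromorphic_on upper_half_plane"
  and meromorphic_g2: "g2 meromorphic_on upper_half_plane"
  and meromorphic_T1: "T1 meromorphic_on upper_half_plane"
  and meromorphic_T2: "T2 meromorphic_on upper_half_plane"
  unfolding g1_def [abs_def] g2_def [abs_def] T1_def [abs_def] T2_def [abs_def] Let_def
  by (intro meromorphic_intros meromorphic_on_qpoch_nome meromorphic_on_qpoch_nome[of 1, simplified])+

text \<open>If A + B = 0, both denominators vanish and both quotients are 0 by convention, so the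
  conversion of \<open>T1\<close> and \<open>T2\<close> also holds at their poles.\<close>

lemma diff_divide_add_eq:
  fixes A B :: complex
  assumes "B \<noteq> 0"
  shows "(A - B) / (A + B) = (A / B - 1) / (A / B + 1)"
proof -
  have "A / B - 1 = (A - B) / B" "A / B + 1 = (A + B) / B"
    using assms by (simp_all add: field_simps)
  thus ?thesis using assms by simp
qed

lemma qpoch_nome_nonzero:
  assumes "Im \<tau> > 0" "n > 0"
  shows "qpoch (nome \<tau> ^ n) (nome \<tau> ^ 5) \<noteq> 0"
  using norm_nome_less_1[OF assms(1)] assms(2)
  by (intro qpoch_nonzero) (auto simp: norm_power power_less_one_iff)

lemma T1_conv_g1: "Im \<tau> > 0 \<Longrightarrow> T1 \<tau> = (g1 \<tau> - 1) / (g1 \<tau> + 1)"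
  unfolding T1_def g1_def Let_def
  using qpoch_nome_nonzero[of \<tau> 1] qpoch_nome_nonzero[of \<tau> 4]
  by (intro diff_divide_add_eq) simp

lemma T2_conv_g2: "Im \<tau> > 0 \<Longrightarrow> T2 \<tau> = (g2 \<tau> - 1) / (g2 \<tau> + 1)"
  unfolding T2_def g2_def Let_def
  using qpoch_nome_nonzero[of \<tau> 2] qpoch_nome_nonzero[of \<tau> 3]
  by (intro diff_divide_add_eq) simp

lemma Gamma1_subset_SL2Z: "Gamma1 N \<subseteq> SL2Z"
  by (auto simp: Gamma1_def SL2Z_def)

lemma Gamma1_40_subset_Gamma1_10: "Gamma1 40 \<subseteq> Gamma1 10"
proof -
  have "x mod 10 = 1" if "x mod 40 = 1" for x :: int
    using that by presburger
  thus ?thesis by (auto simp: Gamma1_def)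
qed

theorem theorem3p4:
  shows "modular_function_on (\<lambda>\<tau>. g1 \<tau> ^ 4) (Gamma1 10)
       \<and> modular_function_on (\<lambda>\<tau>. g2 \<tau> ^ 4) (Gamma1 10)
       \<and> modular_function_on T1 (Gamma1 40)
       \<and> modular_function_on T2 (Gamma1 40)"
proof -
  \<comment> \<open>The fourth power annihilates the multiplier, a fourth root of unity.\<close>
  have inv4: "theta_quot k (5 * moebius \<gamma> \<tau>) ^ 4 = theta_quot k (5 * \<tau>) ^ 4"
    if "\<gamma> \<in> Gamma1 10" "Im \<tau> > 0" for k \<gamma> \<tau>
    using Gamma1_10_multiplier[OF that, of k] by (metis power_mult_distrib mult_1)
  have inv1: "theta_quot k (5 * moebius \<gamma> \<tau>) = theta_quot k (5 * \<tau>)"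
    if "\<gamma> \<in> Gamma1 40" "Im \<tau> > 0" for k \<gamma> \<tau>
    using Gamma1_10_multiplier[of \<gamma> \<tau> k] that Gamma1_40_subset_Gamma1_10 by (metis subsetD mult_1)
  note mero = meromorphic_on_power[OF meromorphic_g1, of 4] meromorphic_on_power[OF meromorphic_g2, of 4]
    meromorphic_T1 meromorphic_T2
  show ?thesis
  proof (intro conjI)
    show "modular_function_on (\<lambda>\<tau>. g1 \<tau> ^ 4) (Gamma1 10)"
      by (rule modular_function_on_theta_quotI[where R = "\<lambda>x. x ^ 4" and k = 1, OF _ _ mero(1)])
         (auto intro: meromorphic_intros inv4 simp: g1_conv_theta_quot Gamma1_subset_SL2Z)
    show "modular_function_on (\<lambda>\<tau>. g2 \<tau> ^ 4) (Gamma1 10)"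
      by (rule modular_function_on_theta_quotI[where R = "\<lambda>x. x ^ 4" and k = 2, OF _ _ mero(2)])
         (auto intro: meromorphic_intros inv4 simp: g2_conv_theta_quot Gamma1_subset_SL2Z)
    show "modular_function_on T1 (Gamma1 40)"
      by (rule modular_function_on_theta_quotI[where R = "\<lambda>x. (x - 1) / (x + 1)" and k = 1, OF _ _ mero(3)])
         (auto intro!: meromorphic_intros
               simp: T1_conv_g1 g1_conv_theta_quot Gamma1_subset_SL2Z inv1)
    show "modular_function_on T2 (Gamma1 40)"
      by (rule modular_function_on_theta_quotI[where R = "\<lambda>x. (x - 1) / (x + 1)" and k = 2, OF _ _ mero(4)])
         (auto intro!: meromorphic_intros
               simp: T2_conv_g2 g2_conv_theta_quot Gamma1_subset_SL2Z inv1)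
  qed
qed

end
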